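(* Let $p_1=2, p_2=3, p_3=5,\dots$ denote the primes in increasing order. For $n\ge 1$ let $$T_n=\frac{\prod_{i=1}^{n-1}(p_i-1)}{\prod_{i=1}^{n}p_i}=\frac{1\cdot 2\cdot 4\cdots (p_{n-1}-1)}{2\cdot 3\cdot 5\cdots p_n},$$ (so $T_1=\tfrac12, T_2=\tfrac16, T_3=\tfrac{2}{30}, T_4=\tfrac{8}{210},\dots$; the empty product equals $1$), and let $S_n=\sum_{i=1}^n T_i$. Then $\lim_{n\to\infty} S_n = 1$.
   Context: Equivalently $T_n=\varphi(p_{n-1}\#)/p_n\#$, where $\varphi$ is Euler's totient function and $p_n\#=p_1p_2\cdots p_n$ is the primorial (with $p_0\#=1$). *)

theory Defs
  imports Complex_Main "HOL-Library.Infinite_Set" "HOL-Computational_Algebra.Primes"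
begin

(* enumerate counts from 0; the shift makes the indexing 1-based, so nth_prime 1 = 2.
   The value at index 0 is junk and is never used below. *)
definition nth_prime :: "nat \<Rightarrow> nat" where
  "nth_prime n = enumerate {p. prime p} (n - 1)"

definition T :: "nat \<Rightarrow> real" where
  "T n = (\<Prod>i = 1..n - 1. real (nth_prime i) - 1) / (\<Prod>i = 1..n. real (nth_prime i))"

definition S :: "nat \<Rightarrow> real" where
  "S n = (\<Sum>i = 1..n. T i)"

end

theory Submission
  imports Defs "HOL-Analysis.Harmonic_Numbers"
begin

text \<open>
  The sum telescopes: \<open>S n = 1 - (\<Prod>i = 1..n. 1 - 1 / nth_prime i)\<close>. It remains to see that this
  product tends to 0, which is Euler's argument: every \<open>m \<le> N\<close> is a product of primes \<open>\<le> N\<close>, so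
  the product over these primes is at most the reciprocal of the \<open>N\<close>-th harmonic number.
\<close>

text \<open>The cutoff \<open>N\<close> keeps every sum finite, so no infinite Euler product or
  convergence argument is needed.\<close>

definition smooth_upto :: "nat set \<Rightarrow> nat \<Rightarrow> nat set" where
  "smooth_upto A N = {m \<in> {1..N}. \<forall>q. prime q \<longrightarrow> q dvd m \<longrightarrow> q \<in> A}"

lemma finite_smooth_upto [simp]: "finite (smooth_upto A N)"
  by (simp add: smooth_upto_def)

text \<open>Each \<open>m\<close> in the larger set is either free of the factor \<open>p\<close> or
  equal to \<open>p * k\<close> with \<open>k\<close> again in that set. Hence its reciprocal sum
  \<open>s\<close> satisfies \<open>s \<le> a + s / p\<close>, where \<open>a\<close> is the sum for
  \<open>A\<close>. Only an inequality results, since \<open>p * k\<close> may exceed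
  \<open>N\<close>.\<close>

lemma sum_inverse_smooth_upto_insert:
  assumes "prime p"
  shows "(1 - 1 / real p) * (\<Sum>m\<in>smooth_upto (insert p A) N. 1 / real m)
           \<le> (\<Sum>m\<in>smooth_upto A N. 1 / real m)"
proof -
  let ?B = "smooth_upto (insert p A) N"
  have p: "p > 0"
    using assms by (rule prime_gt_0_nat)
  have sub: "?B \<subseteq> smooth_upto A N \<union> (*) p ` ?B"
  proof
    fix m assume m: "m \<in> ?B"
    show "m \<in> smooth_upto A N \<union> (*) p ` ?B"
    proof (cases "p dvd m")
      case True
      then obtain k where k: "m = p * k" by blast
      have "k > 0" "k \<le> m" "k dvd m"
        using m p by (auto simp: k smooth_upto_def)
      then have "k \<in> ?B"
        using m by (auto simp: smooth_upto_def intro: dvd_trans)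
      then show ?thesis using k by blast
    qed (use m in \<open>auto simp: smooth_upto_def\<close>)
  qed
  have "(\<Sum>m\<in>?B. 1 / real m) \<le> (\<Sum>m\<in>smooth_upto A N \<union> (*) p ` ?B. 1 / real m)"
    by (rule sum_mono2) (use sub in auto)
  also have "\<dots> \<le> (\<Sum>m\<in>smooth_upto A N. 1 / real m) + (\<Sum>m\<in>(*) p ` ?B. 1 / real m)"
    by (simp add: sum_Un sum_nonneg)
  also have "(\<Sum>m\<in>(*) p ` ?B. 1 / real m) = (\<Sum>m\<in>?B. 1 / real p * (1 / real m))"
    by (subst sum.reindex) (use p in \<open>auto simp: inj_on_def\<close>)
  also have "\<dots> = 1 / real p * (\<Sum>m\<in>?B. 1 / real m)"
    by (simp add: sum_distrib_left)
  finally show ?thesis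
    by (simp add: left_diff_distrib)
qed

text \<open>A truncated Euler product: induction on \<open>A\<close> absorbs the factor of one prime
  at a time.\<close>

lemma prod_primes_mult_sum_smooth_upto_le_1:
  assumes "finite A" "\<And>p. p \<in> A \<Longrightarrow> prime p"
  shows "(\<Prod>p\<in>A. 1 - 1 / real p) * (\<Sum>m\<in>smooth_upto A N. 1 / real m) \<le> 1"
  using assms
proof (induction A rule: finite_induct)
  case empty
  \<comment> \<open>Only 1 has no prime divisor.\<close>
  have "smooth_upto {} N \<subseteq> {1}"
    using prime_factor_nat by (fastforce simp: smooth_upto_def)
  then have "(\<Sum>m\<in>smooth_upto {} N. 1 / real m) \<le> (\<Sum>m\<in>{1}. 1 / real m)"
    by (intro sum_mono2) auto
  then show ?case by simp
next
  case (insert p A)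
  have "(\<Prod>q\<in>A. 1 - 1 / real q) \<ge> 0"
    by (intro prod_nonneg) (auto simp: insert.prems prime_gt_0_nat Suc_leI)
  then have "(\<Prod>q\<in>A. 1 - 1 / real q)
      * ((1 - 1 / real p) * (\<Sum>m\<in>smooth_upto (insert p A) N. 1 / real m))
    \<le> (\<Prod>q\<in>A. 1 - 1 / real q) * (\<Sum>m\<in>smooth_upto A N. 1 / real m)"
    by (intro mult_left_mono sum_inverse_smooth_upto_insert) (auto simp: insert.prems)
  also have "\<dots> \<le> 1"
    using insert by auto
  finally show ?case
    using insert.hyps by (simp add: mult_ac)
qed

lemma prime_nth_prime: "prime (nth_prime n)"
  using enumerate_in_set[OF primes_infinite] by (simp add: nth_prime_def)

text \<open>Index 0 has to be left out: truncated subtraction gives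
  \<open>nth_prime 0 = nth_prime 1\<close>.\<close>

lemma inj_on_nth_prime: "inj_on nth_prime {1..n}"
proof (rule inj_onI)
  fix i j assume ij: "i \<in> {1..n}" "j \<in> {1..n}" "nth_prime i = nth_prime j"
  then have "i - 1 = j - 1"
    using inj_enumerate[OF primes_infinite] by (simp add: nth_prime_def inj_def)
  then show "i = j" using ij by auto
qed

lemma prime_in_image_nth_prime:
  assumes "prime q" "q \<le> n"
  shows "q \<in> nth_prime ` {1..Suc n}"
proof -
  obtain k where k: "enumerate {p. prime p} k = q"
    using enumerate_Ex[of "{p. prime p}" q] primes_infinite assms by auto
  \<comment> \<open>The enumeration is strictly increasing, so its value at \<open>k\<close> is at
    least \<open>k\<close>; thus \<open>k \<le> q \<le> n\<close>.\<close>
  then have "k \<le> n"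
    using le_enumerate[OF primes_infinite, of k] assms by simp
  then show ?thesis
    using k by (intro image_eqI[of _ _ "Suc k"]) (auto simp: nth_prime_def)
qed

lemma prod_primes_mult_harm_le_1:
  "(\<Prod>i = 1..Suc n. 1 - 1 / real (nth_prime i)) * harm n \<le> 1"
proof -
  let ?A = "nth_prime ` {1..Suc n}"
  \<comment> \<open>A prime divisor of \<open>m \<le> n\<close> is itself at most \<open>n\<close>,
    so it is among the first \<open>n + 1\<close> primes.\<close>
  have "q \<in> ?A" if "prime q" "q dvd m" "m \<in> {1..n}" for q m
    using that dvd_imp_le[of q m] by (intro prime_in_image_nth_prime) auto
  then have "smooth_upto ?A n = {1..n}"
    unfolding smooth_upto_def by blast
  then have "harm n = (\<Sum>m\<in>smooth_upto ?A n. 1 / real m)"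
    by (simp add: harm_def inverse_eq_divide)
  moreover have "(\<Prod>i = 1..Suc n. 1 - 1 / real (nth_prime i)) = (\<Prod>p\<in>?A. 1 - 1 / real p)"
    by (simp only: prod.reindex[OF inj_on_nth_prime] o_def)
  moreover have "(\<Prod>p\<in>?A. 1 - 1 / real p) * (\<Sum>m\<in>smooth_upto ?A n. 1 / real m) \<le> 1"
    by (rule prod_primes_mult_sum_smooth_upto_le_1) (auto simp: prime_nth_prime)
  ultimately show ?thesis by simp
qed

text \<open>After a shift by one, the product lies between 0 and \<open>inverse (harm n)\<close>,
  and the harmonic series diverges.\<close>

lemma prod_primes_tendsto_0:
  "(\<lambda>n. \<Prod>i = 1..n. 1 - 1 / real (nth_prime i)) \<longlonglongrightarrow> 0"
proof (rule LIMSEQ_imp_Suc, rule tendsto_sandwich)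
  have "(\<Prod>i = 1..Suc n. 1 - 1 / real (nth_prime i)) \<ge> 0" for n
    by (intro prod_nonneg) (auto simp: prime_nth_prime prime_gt_0_nat Suc_leI)
  then show "\<forall>\<^sub>F n in sequentially. 0 \<le> (\<Prod>i = 1..Suc n. 1 - 1 / real (nth_prime i))"
    by simp
  show "\<forall>\<^sub>F n in sequentially.
      (\<Prod>i = 1..Suc n. 1 - 1 / real (nth_prime i)) \<le> inverse (harm n)"
    \<comment> \<open>The bound fails at \<open>n = 0\<close>: the product is 1/2, but
      \<open>harm 0 = 0\<close> and \<open>inverse 0 = 0\<close>.\<close>
    using eventually_gt_at_top[of 0]
  proof eventually_elim
    case (elim n)
    then have "harm n > (0::real)" by (rule harm_pos)
    then show ?case
      using prod_primes_mult_harm_le_1[of n]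
      by (simp only: inverse_eq_divide pos_le_divide_eq)
  qed
  show "(\<lambda>n. inverse (harm n :: real)) \<longlonglongrightarrow> 0"
    by (rule tendsto_inverse_0_at_top[OF harm_at_top])
qed simp

text \<open>Writing \<open>P n\<close> for the product,
  \<open>T (Suc n) = P n / nth_prime (Suc n) = P n - P (Suc n)\<close>, so the sum telescopes from
  \<open>P 0 = 1\<close>.\<close>

lemma S_eq: "S n = 1 - (\<Prod>i = 1..n. 1 - 1 / real (nth_prime i))"
proof (induction n)
  case (Suc n)
  have nz: "real (nth_prime i) \<noteq> 0" for i
    using prime_gt_0_nat[OF prime_nth_prime[of i]] by simp
  have "T (Suc n) = (\<Prod>i = 1..n. (real (nth_prime i) - 1) / real (nth_prime i))
                      / real (nth_prime (Suc n))"
    by (simp add: T_def prod_dividef)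
  also have "(\<Prod>i = 1..n. (real (nth_prime i) - 1) / real (nth_prime i))
               = (\<Prod>i = 1..n. 1 - 1 / real (nth_prime i))"
    by (intro prod.cong refl) (simp add: diff_divide_distrib nz del: of_nat_eq_0_iff)
  finally show ?case
    using Suc.IH by (simp add: S_def algebra_simps)
qed (simp add: S_def)

theorem theorem1:
  shows "S \<longlonglongrightarrow> 1"
  using tendsto_diff[OF tendsto_const[of 1] prod_primes_tendsto_0]
  by (simp add: S_eq[abs_def])

end
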